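(* Let $\alpha>-1$, let $n\ge 2$ be an integer, and let $H=\mathcal{A}_n^2(\mathbb{D},\mu_\alpha)$. Then the set $\{T^{(\alpha)}_{n,a}:\ a\in L^\infty(\mathbb{D})\}$ of the Toeplitz operators with bounded symbols is not weakly dense in $\mathcal{B}(H)$.
   Context: $\mathbb{D}$ is the open unit disk, and $\mathrm{d}\mu_\alpha(z)=\frac{\alpha+1}{\pi}(1-|z|^2)^\alpha\,\mathrm{d}\mu(z)$ on $\mathbb{D}$, where $\mu$ is Lebesgue plane measure. A function $f$ is $n$-analytic if it is smooth and $(\partial/\partial\overline{z})^n f=0$. $\mathcal{A}_n^2(\mathbb{D},\mu_\alpha)$ is the space of $n$-analytic functions on $\mathbb{D}$ that are square-integrable with respect to $\mu_\alpha$; it is a closed subspace of $L^2(\mathbb{D},\mu_\alpha)$. $\mathcal{B}(H)$ is the algebra of all bounded linear operators on $H$; "weakly dense" means dense in the weak operator topology. For $a\in L^\infty(\mathbb{D})$, the Toeplitz operator $T^{(\alpha)}_{n,a}$ on $H$ is $T^{(\alpha)}_{n,a}f=P(af)$, where $P$ is the orthogonal projection of $L^2(\mathbb{D},\mu_\alpha)$ onto $H$. *)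

theory Defs
  imports "HOL-Analysis.Analysis"
begin

section \<open>Square-integrable functions and orthogonal projections\<close>

definition sq_integrable :: "complex measure \<Rightarrow> (complex \<Rightarrow> complex) \<Rightarrow> bool" where
  "sq_integrable M f \<longleftrightarrow>
     f \<in> borel_measurable M \<and> integrable M (\<lambda>z. (cmod (f z))\<^sup>2)"

definition l2_inner :: "complex measure \<Rightarrow> (complex \<Rightarrow> complex) \<Rightarrow> (complex \<Rightarrow> complex) \<Rightarrow> complex" where
  "l2_inner M f g = (LINT z|M. f z * cnj (g z))"

definition l2_norm :: "complex measure \<Rightarrow> (complex \<Rightarrow> complex) \<Rightarrow> real" where
  "l2_norm M f = sqrt (LINT z|M. (cmod (f z))\<^sup>2)"

text \<open>Here \<open>H\<close> is a set of honest functions, standing for a closed subspace of \<open>L\<^sup>2(M)\<close>;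
  distinct members of \<open>H\<close> should lie in distinct \<open>L\<^sup>2\<close>-classes, so that the element described
  below is unique.\<close>

definition orth_proj ::
  "complex measure \<Rightarrow> (complex \<Rightarrow> complex) set \<Rightarrow> (complex \<Rightarrow> complex) \<Rightarrow> (complex \<Rightarrow> complex)" where
  "orth_proj M H u = (THE h. h \<in> H \<and> (\<forall>g\<in>H. l2_inner M (\<lambda>z. u z - h z) g = 0))"

section \<open>Bounded operators and the weak operator topology\<close>

text \<open>Operators are extensional (\<open>undefined\<close> outside \<open>H\<close>), so that each bounded operator on \<open>H\<close>
  is represented exactly once.\<close>

definition bounded_ops ::
  "complex measure \<Rightarrow> (complex \<Rightarrow> complex) set \<Rightarrow> ((complex \<Rightarrow> complex) \<Rightarrow> (complex \<Rightarrow> complex)) set" where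
  "bounded_ops M H = {T \<in> H \<rightarrow>\<^sub>E H.
     (\<forall>f\<in>H. \<forall>g\<in>H. T (\<lambda>z. f z + g z) = (\<lambda>z. T f z + T g z)) \<and>
     (\<forall>c. \<forall>f\<in>H. T (\<lambda>z. c * f z) = (\<lambda>z. c * T f z)) \<and>
     (\<exists>C. \<forall>f\<in>H. l2_norm M (T f) \<le> C * l2_norm M f)}"

definition weak_operator_topology ::
  "complex measure \<Rightarrow> (complex \<Rightarrow> complex) set \<Rightarrow> ((complex \<Rightarrow> complex) \<Rightarrow> (complex \<Rightarrow> complex)) topology" where
  "weak_operator_topology M H = topology_generated_by
     {{T \<in> bounded_ops M H. l2_inner M (T f) g \<in> U} | f g U. f \<in> H \<and> g \<in> H \<and> open U}"

definition weakly_dense ::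
  "complex measure \<Rightarrow> (complex \<Rightarrow> complex) set \<Rightarrow> ((complex \<Rightarrow> complex) \<Rightarrow> (complex \<Rightarrow> complex)) set \<Rightarrow> bool" where
  "weakly_dense M H S \<longleftrightarrow> weak_operator_topology M H closure_of S = bounded_ops M H"

section \<open>Polyanalytic Bergman spaces and Toeplitz operators\<close>

primrec Ck_on :: "nat \<Rightarrow> 'a::real_normed_vector set \<Rightarrow> ('a \<Rightarrow> 'b::real_normed_vector) \<Rightarrow> bool" where
  "Ck_on 0 S f \<longleftrightarrow> continuous_on S f"
| "Ck_on (Suc k) S f \<longleftrightarrow>
     (\<forall>x\<in>S. f differentiable (at x)) \<and> (\<forall>v. Ck_on k S (\<lambda>x. frechet_derivative f (at x) v))"

text \<open>Smoothness is meant in the real sense and \<open>S\<close> is meant to be open.\<close>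

definition smooth_on :: "'a::real_normed_vector set \<Rightarrow> ('a \<Rightarrow> 'b::real_normed_vector) \<Rightarrow> bool" where
  "smooth_on S f \<longleftrightarrow> (\<forall>k. Ck_on k S f)"

text \<open>\<open>\<partial>/\<partial>cnj z = (\<partial>/\<partial>x + \<i> \<partial>/\<partial>y)/2\<close>\<close>

definition dbar :: "(complex \<Rightarrow> complex) \<Rightarrow> complex \<Rightarrow> complex" where
  "dbar f z = (frechet_derivative f (at z) 1 + \<i> * frechet_derivative f (at z) \<i>) / 2"

definition n_analytic_on :: "nat \<Rightarrow> complex set \<Rightarrow> (complex \<Rightarrow> complex) \<Rightarrow> bool" where
  "n_analytic_on n S f \<longleftrightarrow> smooth_on S f \<and> (\<forall>z\<in>S. (dbar ^^ n) f z = 0)"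

abbreviation unit_disk :: "complex set" where
  "unit_disk \<equiv> ball 0 1"

definition disk_measure :: "real \<Rightarrow> complex measure" where
  "disk_measure \<alpha> = density (lebesgue_on unit_disk)
     (\<lambda>z. ennreal ((\<alpha> + 1) / pi * (1 - (cmod z)\<^sup>2) powr \<alpha>))"

text \<open>A function on the disk is represented by its extension by zero, so that the pointwise vector
  space operations of \<open>complex \<Rightarrow> complex\<close> can be used and members agreeing on the disk are equal.\<close>

definition poly_bergman :: "nat \<Rightarrow> real \<Rightarrow> (complex \<Rightarrow> complex) set" where
  "poly_bergman n \<alpha> = {f. (\<forall>z. z \<notin> unit_disk \<longrightarrow> f z = 0) \<and>
     n_analytic_on n unit_disk f \<and> sq_integrable (disk_measure \<alpha>) f}"

definition Linfty_disk :: "(complex \<Rightarrow> complex) set" where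
  "Linfty_disk = {a. a \<in> borel_measurable (lebesgue_on unit_disk) \<and>
     (\<exists>C. AE z in lebesgue_on unit_disk. cmod (a z) \<le> C)}"

definition toeplitz ::
  "nat \<Rightarrow> real \<Rightarrow> (complex \<Rightarrow> complex) \<Rightarrow> (complex \<Rightarrow> complex) \<Rightarrow> (complex \<Rightarrow> complex)" where
  "toeplitz n \<alpha> a = (\<lambda>f \<in> poly_bergman n \<alpha>.
     orth_proj (disk_measure \<alpha>) (poly_bergman n \<alpha>) (\<lambda>z. a z * f z))"

end

theory Submission
  imports Defs
begin

text \<open>For \<open>n \<ge> 2\<close> the functions \<open>1\<close>, \<open>z\<close> and \<open>cnj z\<close> all lie in \<open>H\<close>, and \<open>\<langle>T f, g\<rangle>\<close> depends only on
  \<open>f cnj g\<close> when \<open>T\<close> is a Toeplitz operator. Hence the weakly continuous functional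
  \<open>T \<mapsto> \<langle>T z, 1\<rangle> - \<langle>T 1, cnj z\<rangle>\<close> vanishes on all Toeplitz operators. It does not vanish on the
  rank-one operator \<open>f \<mapsto> \<langle>f, h\<rangle> 1\<close> with \<open>h = \<langle>1, 1\<rangle> z - \<langle>1, cnj z\<rangle> 1\<close>, where its value is
  \<open>\<langle>h, h\<rangle>\<close>.\<close>

section \<open>Smooth functions on open sets\<close>

text \<open>\<open>frechet_derivative\<close> is a choice among all derivatives at a point. Two
  functions agreeing near that point have the same derivatives there, hence the same choice, even if
  there are none.\<close>

lemma frechet_derivative_cong_open:
  assumes "open S" "x \<in> S" "\<And>y. y \<in> S \<Longrightarrow> f y = g y"
  shows "frechet_derivative f (at x) = frechet_derivative g (at x)"
proof -
  have "(f has_derivative D) (at x) \<longleftrightarrow> (g has_derivative D) (at x)" for D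
    using assms has_derivative_transform_within_open[of f D x UNIV S g]
      has_derivative_transform_within_open[of g D x UNIV S f] by auto
  then show ?thesis
    by (simp add: frechet_derivative_def)
qed

lemma differentiable_cong_open:
  assumes "open S" "x \<in> S" "\<And>y. y \<in> S \<Longrightarrow> f y = g y"
  shows "f differentiable (at x) \<longleftrightarrow> g differentiable (at x)"
  using assms has_derivative_transform_within_open[of f _ x UNIV S g]
      has_derivative_transform_within_open[of g _ x UNIV S f]
  unfolding differentiable_def by metis

text \<open>Members of the Bergman space are extended by zero, so smoothness has to pass between a
  function and its extension. Both functions stay arbitrary in the induction because the step
  replaces them by directional derivatives.\<close>

lemma Ck_on_cong:
  assumes "open S" "\<And>x. x \<in> S \<Longrightarrow> f x = g x"
  shows "Ck_on k S f \<longleftrightarrow> Ck_on k S g"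
  using assms(2)
proof (induction k arbitrary: f g)
  case 0
  then show ?case by (auto cong: continuous_on_cong)
next
  case (Suc k)
  have "Ck_on k S (\<lambda>x. frechet_derivative f (at x) v) \<longleftrightarrow>
        Ck_on k S (\<lambda>x. frechet_derivative g (at x) v)" for v
    by (rule Suc.IH) (simp add: frechet_derivative_cong_open[OF assms(1) _ Suc.prems])
  then show ?case
    using differentiable_cong_open[OF assms(1) _ Suc.prems] by simp
qed

lemma Ck_on_const:
  assumes "open S"
  shows "Ck_on k S (\<lambda>x. c)"
proof (induction k arbitrary: c)
  case (Suc k)
  then show ?case by (simp add: frechet_derivative_const)
qed simp

text \<open>A bounded linear map is its own derivative at every point, so its directional
  derivatives are constants. The instances of interest are the identity and
  \<open>cnj\<close>.\<close>

lemma Ck_on_bounded_linear: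
  assumes "bounded_linear L" "open S"
  shows "Ck_on k S L"
proof (cases k)
  case 0
  then show ?thesis using assms by (simp add: linear_continuous_on)
next
  case (Suc m)
  have "(L has_derivative L) (at x)" for x
    using assms(1) by (rule bounded_linear_imp_has_derivative)
  then have "frechet_derivative L (at x) = L" "L differentiable (at x)" for x
    using frechet_derivative_at by (metis, metis differentiableI)
  then show ?thesis
    by (simp add: Suc Ck_on_const[OF assms(2)])
qed

lemma frechet_derivative_add:
  assumes "f differentiable (at x)" "g differentiable (at x)"
  shows "frechet_derivative (\<lambda>x. f x + g x) (at x) =
    (\<lambda>v. frechet_derivative f (at x) v + frechet_derivative g (at x) v)"
  using has_derivative_add[OF assms[unfolded frechet_derivative_works]]
  by (rule frechet_derivative_at[symmetric])

text \<open>The sum rule is available only at points of \<open>S\<close>, so the derivative of the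
  sum is exchanged for the sum of the derivatives through \<open>Ck_on_cong\<close>.\<close>

lemma Ck_on_add:
  assumes "open S" "Ck_on k S f" "Ck_on k S g"
  shows "Ck_on k S (\<lambda>x. f x + g x)"
  using assms(2,3)
proof (induction k arbitrary: f g)
  case 0
  then show ?case by (simp add: continuous_on_add)
next
  case (Suc k)
  have "Ck_on k S (\<lambda>x. frechet_derivative f (at x) v + frechet_derivative g (at x) v)" for v
    using Suc by simp
  moreover have "frechet_derivative (\<lambda>x. f x + g x) (at x) v =
      frechet_derivative f (at x) v + frechet_derivative g (at x) v" if "x \<in> S" for x v
    using that Suc.prems by (simp add: frechet_derivative_add)
  ultimately have "Ck_on k S (\<lambda>x. frechet_derivative (\<lambda>x. f x + g x) (at x) v)" for v
    using Ck_on_cong[OF assms(1)] by (metis (mono_tags, lifting))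
  then show ?case
    using Suc.prems by simp
qed

lemma frechet_derivative_cmult:
  fixes f :: "'a::real_normed_vector \<Rightarrow> 'b::real_normed_algebra"
  assumes "f differentiable (at x)"
  shows "frechet_derivative (\<lambda>x. c * f x) (at x) = (\<lambda>v. c * frechet_derivative f (at x) v)"
proof -
  have "(f has_derivative frechet_derivative f (at x)) (at x)"
    using assms frechet_derivative_works by blast
  then have "((\<lambda>x. c * f x) has_derivative (\<lambda>v. c * frechet_derivative f (at x) v)) (at x)"
    by (rule has_derivative_mult_right)
  then show ?thesis
    using frechet_derivative_at by metis
qed

lemma Ck_on_cmult:
  fixes f :: "'a::real_normed_vector \<Rightarrow> 'b::real_normed_algebra"
  assumes "open S" "Ck_on k S f"
  shows "Ck_on k S (\<lambda>x. c * f x)"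
  using assms(2)
proof (induction k arbitrary: f)
  case 0
  then show ?case by (simp add: continuous_on_mult_left)
next
  case (Suc k)
  have "Ck_on k S (\<lambda>x. c * frechet_derivative f (at x) v)" for v
    using Suc by simp
  moreover have "frechet_derivative (\<lambda>x. c * f x) (at x) v =
      c * frechet_derivative f (at x) v" if "x \<in> S" for x v
    using that Suc.prems by (simp add: frechet_derivative_cmult)
  ultimately have "Ck_on k S (\<lambda>x. frechet_derivative (\<lambda>x. c * f x) (at x) v)" for v
    using Ck_on_cong[OF assms(1)] by (metis (mono_tags, lifting))
  then show ?case
    using Suc.prems by (auto intro: differentiable_mult)
qed

lemma smooth_on_cong:
  assumes "open S" "\<And>x. x \<in> S \<Longrightarrow> f x = g x"
  shows "smooth_on S f \<longleftrightarrow> smooth_on S g"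
  using Ck_on_cong[OF assms] by (simp add: smooth_on_def)

lemma smooth_on_add:
  "open S \<Longrightarrow> smooth_on S f \<Longrightarrow> smooth_on S g \<Longrightarrow> smooth_on S (\<lambda>x. f x + g x)"
  by (simp add: smooth_on_def Ck_on_add)

lemma smooth_on_cmult:
  fixes f :: "'a::real_normed_vector \<Rightarrow> 'b::real_normed_algebra"
  shows "open S \<Longrightarrow> smooth_on S f \<Longrightarrow> smooth_on S (\<lambda>x. c * f x)"
  by (simp add: smooth_on_def Ck_on_cmult)

lemma smooth_on_imp_differentiable:
  assumes "smooth_on S f" "x \<in> S"
  shows "f differentiable (at x)"
proof -
  have "Ck_on (Suc 0) S f"
    using assms(1) unfolding smooth_on_def by blast
  with assms(2) show ?thesis by simp
qed

lemma smooth_on_frechet_derivative: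
  assumes "smooth_on S f"
  shows "smooth_on S (\<lambda>x. frechet_derivative f (at x) v)"
  unfolding smooth_on_def
proof
  fix k
  have "Ck_on (Suc k) S f"
    using assms unfolding smooth_on_def by blast
  then show "Ck_on k S (\<lambda>x. frechet_derivative f (at x) v)" by simp
qed

section \<open>The Cauchy--Riemann operator\<close>

lemma dbar_cong:
  assumes "open S" "z \<in> S" "\<And>x. x \<in> S \<Longrightarrow> f x = g x"
  shows "dbar f z = dbar g z"
  using frechet_derivative_cong_open[OF assms] by (simp add: dbar_def)

lemma dbar_funpow_cong:
  assumes "open S" "z \<in> S" "\<And>x. x \<in> S \<Longrightarrow> f x = g x"
  shows "(dbar ^^ n) f z = (dbar ^^ n) g z"
  using assms(2)
proof (induction n arbitrary: z)
  case (Suc n)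
  then show ?case
    using dbar_cong[OF assms(1), of z "(dbar ^^ n) f" "(dbar ^^ n) g"] by simp
qed (simp add: assms(3))

lemma smooth_on_dbar:
  assumes "open S" "smooth_on S f"
  shows "smooth_on S (dbar f)"
proof -
  have "smooth_on S (\<lambda>z. (1/2) * (frechet_derivative f (at z) 1 + \<i> * frechet_derivative f (at z) \<i>))"
    using assms by (intro smooth_on_cmult smooth_on_add smooth_on_frechet_derivative)
  moreover have "dbar f = (\<lambda>z. (1/2) * (frechet_derivative f (at z) 1 + \<i> * frechet_derivative f (at z) \<i>))"
    by (simp add: dbar_def fun_eq_iff)
  ultimately show ?thesis by simp
qed

lemma dbar_has_derivative:
  assumes "(f has_derivative D) (at z)"
  shows "dbar f z = (D 1 + \<i> * D \<i>) / 2"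
  using frechet_derivative_at[OF assms] by (simp add: dbar_def)

lemma dbar_const: "dbar (\<lambda>z. c) = (\<lambda>z. 0)"
  by (simp add: fun_eq_iff dbar_def frechet_derivative_const)

lemma dbar_ident: "dbar (\<lambda>z. z) = (\<lambda>z. 0)"
  using dbar_has_derivative[OF has_derivative_ident] by (simp add: fun_eq_iff)

lemma dbar_cnj: "dbar cnj = (\<lambda>z. 1)"
  using dbar_has_derivative[OF bounded_linear_imp_has_derivative[OF bounded_linear_cnj]]
  by (simp add: fun_eq_iff)

lemma dbar_funpow_zero: "(dbar ^^ n) (\<lambda>z. 0) = (\<lambda>z. 0)"
  by (induction n) (simp_all add: dbar_const)

text \<open>The innermost \<open>dbar\<close> is split first: it is additive on all of
  \<open>S\<close>, and \<open>smooth_on_dbar\<close> keeps both summands smooth for the induction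
  hypothesis.\<close>

lemma dbar_funpow_add:
  assumes "open S" "smooth_on S f" "smooth_on S g" "z \<in> S"
  shows "(dbar ^^ n) (\<lambda>z. f z + g z) z = (dbar ^^ n) f z + (dbar ^^ n) g z"
  using assms(2,3)
proof (induction n arbitrary: f g)
  case (Suc n)
  have "dbar (\<lambda>z. f z + g z) w = dbar f w + dbar g w" if "w \<in> S" for w
    using smooth_on_imp_differentiable[OF Suc.prems(1) that]
      smooth_on_imp_differentiable[OF Suc.prems(2) that]
    by (simp add: dbar_def frechet_derivative_add algebra_simps add_divide_distrib)
  then have "(dbar ^^ n) (dbar (\<lambda>z. f z + g z)) z = (dbar ^^ n) (\<lambda>w. dbar f w + dbar g w) z"
    by (rule dbar_funpow_cong[OF assms(1,4)])
  also have "\<dots> = (dbar ^^ n) (dbar f) z + (dbar ^^ n) (dbar g) z"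
    using Suc smooth_on_dbar[OF assms(1)] by blast
  finally show ?case
    by (simp add: funpow_swap1)
qed simp

lemma dbar_funpow_cmult:
  assumes "open S" "smooth_on S f" "z \<in> S"
  shows "(dbar ^^ n) (\<lambda>z. c * f z) z = c * (dbar ^^ n) f z"
  using assms(2)
proof (induction n arbitrary: f)
  case (Suc n)
  have "dbar (\<lambda>z. c * f z) w = c * dbar f w" if "w \<in> S" for w
    using smooth_on_imp_differentiable[OF Suc.prems that]
    by (simp add: dbar_def frechet_derivative_cmult algebra_simps)
  then have "(dbar ^^ n) (dbar (\<lambda>z. c * f z)) z = (dbar ^^ n) (\<lambda>w. c * dbar f w) z"
    by (rule dbar_funpow_cong[OF assms(1,3)])
  also have "\<dots> = c * (dbar ^^ n) (dbar f) z"
    using Suc smooth_on_dbar[OF assms(1)] by blast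
  finally show ?case
    by (simp add: funpow_swap1)
qed simp

section \<open>Closure properties and basic examples of n-analytic functions\<close>

lemma n_analytic_on_cong:
  assumes "open S" "\<And>x. x \<in> S \<Longrightarrow> f x = g x"
  shows "n_analytic_on n S f \<longleftrightarrow> n_analytic_on n S g"
  using smooth_on_cong[OF assms] dbar_funpow_cong[OF assms(1) _ assms(2)]
  by (simp add: n_analytic_on_def)

lemma n_analytic_on_add:
  "open S \<Longrightarrow> n_analytic_on n S f \<Longrightarrow> n_analytic_on n S g \<Longrightarrow> n_analytic_on n S (\<lambda>z. f z + g z)"
  by (simp add: n_analytic_on_def smooth_on_add dbar_funpow_add)

lemma n_analytic_on_cmult:
  "open S \<Longrightarrow> n_analytic_on n S f \<Longrightarrow> n_analytic_on n S (\<lambda>z. c * f z)"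
  by (simp add: n_analytic_on_def smooth_on_cmult dbar_funpow_cmult)

lemma n_analytic_onI:
  assumes "smooth_on S f" "(dbar ^^ 2) f = (\<lambda>z. 0)" "2 \<le> n"
  shows "n_analytic_on n S f"
proof -
  have "(dbar ^^ n) f = (dbar ^^ (n - 2)) ((dbar ^^ 2) f)"
    using assms(3) by (metis comp_apply funpow_add le_add_diff_inverse2)
  then show ?thesis
    using assms by (simp add: n_analytic_on_def dbar_funpow_zero)
qed

text \<open>Order two is forced by \<open>cnj\<close>: one \<open>dbar\<close> turns it into 1 and
  only the second gives 0.\<close>

lemma n_analytic_on_basic:
  assumes "open S" "2 \<le> n"
  shows "n_analytic_on n S (\<lambda>z. c)" "n_analytic_on n S (\<lambda>z. z)" "n_analytic_on n S cnj"
  using assms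
  by (auto intro!: n_analytic_onI Ck_on_const Ck_on_bounded_linear bounded_linear_ident bounded_linear_cnj
      simp: smooth_on_def numeral_2_eq_2 dbar_const dbar_ident dbar_cnj)

section \<open>Square-integrable functions\<close>

text \<open>The domination is almost everywhere so that the lemma applies to products with an
  essentially bounded symbol.\<close>

lemma sq_integrable_bound:
  assumes "sq_integrable M f" "g \<in> borel_measurable M" "AE z in M. cmod (g z) \<le> C * cmod (f z)"
  shows "sq_integrable M g"
  unfolding sq_integrable_def
proof
  have "integrable M (\<lambda>z. C\<^sup>2 * (cmod (f z))\<^sup>2)"
    using assms(1) by (simp add: sq_integrable_def)
  moreover have "AE z in M. norm ((cmod (g z))\<^sup>2) \<le> norm (C\<^sup>2 * (cmod (f z))\<^sup>2)"
    using assms(3)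
  proof eventually_elim
    case (elim z)
    then show ?case
      using power_mono[OF elim, of 2] by (simp add: power_mult_distrib)
  qed
  ultimately show "integrable M (\<lambda>z. (cmod (g z))\<^sup>2)"
    using assms(2) by (elim Bochner_Integration.integrable_bound) auto
qed (fact assms(2))

lemma sq_integrable_cmult: "sq_integrable M f \<Longrightarrow> sq_integrable M (\<lambda>z. c * f z)"
  by (rule sq_integrable_bound[where C = "cmod c" and f = f])
    (auto simp: sq_integrable_def norm_mult)

lemma sq_integrable_add:
  assumes "sq_integrable M f" "sq_integrable M g"
  shows "sq_integrable M (\<lambda>z. f z + g z)"
  unfolding sq_integrable_def
proof
  show meas: "(\<lambda>z. f z + g z) \<in> borel_measurable M"
    using assms by (auto simp: sq_integrable_def intro: borel_measurable_add)
  have "integrable M (\<lambda>z. 2 * (cmod (f z))\<^sup>2 + 2 * (cmod (g z))\<^sup>2)"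
    using assms by (simp add: sq_integrable_def)
  moreover have "(cmod (f z + g z))\<^sup>2 \<le> 2 * (cmod (f z))\<^sup>2 + 2 * (cmod (g z))\<^sup>2" for z
    using power_mono[OF norm_triangle_ineq[of "f z" "g z"], of 2]
      sum_squares_bound[of "cmod (f z)" "cmod (g z)"]
    by (simp add: power2_sum)
  ultimately show "integrable M (\<lambda>z. (cmod (f z + g z))\<^sup>2)"
    using meas by (elim Bochner_Integration.integrable_bound) auto
qed

lemma sq_integrable_mult_cnj:
  assumes "sq_integrable M f" "sq_integrable M g"
  shows "integrable M (\<lambda>z. f z * cnj (g z))"
proof -
  have "integrable M (\<lambda>z. (cmod (f z))\<^sup>2 + (cmod (g z))\<^sup>2)"
    using assms by (simp add: sq_integrable_def)
  moreover have "cmod (f z * cnj (g z)) \<le> (cmod (f z))\<^sup>2 + (cmod (g z))\<^sup>2" for z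
  proof -
    have "2 * (cmod (f z) * cmod (g z)) \<le> (cmod (f z))\<^sup>2 + (cmod (g z))\<^sup>2"
      using sum_squares_bound[of "cmod (f z)" "cmod (g z)"] by simp
    moreover have "0 \<le> cmod (f z) * cmod (g z)" by simp
    ultimately show ?thesis by (simp only: norm_mult complex_mod_cnj)
  qed
  moreover have "(\<lambda>z. f z * cnj (g z)) \<in> borel_measurable M"
    using assms by (auto simp: sq_integrable_def intro!: borel_measurable_times
        measurable_compose[OF _ borel_measurable_continuous_onI[OF continuous_on_cnj[OF continuous_on_id]]])
  ultimately show ?thesis
    by (elim Bochner_Integration.integrable_bound) auto
qed

section \<open>The inner product and its boundedness in the first argument\<close>

lemma l2_inner_add_left:
  assumes "sq_integrable M f" "sq_integrable M g" "sq_integrable M h"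
  shows "l2_inner M (\<lambda>z. f z + g z) h = l2_inner M f h + l2_inner M g h"
  using assms by (simp add: l2_inner_def ring_distribs sq_integrable_mult_cnj)

lemma l2_inner_diff_left:
  assumes "sq_integrable M f" "sq_integrable M g" "sq_integrable M h"
  shows "l2_inner M (\<lambda>z. f z - g z) h = l2_inner M f h - l2_inner M g h"
  using assms by (simp add: l2_inner_def ring_distribs sq_integrable_mult_cnj)

lemma l2_inner_cmult_left: "l2_inner M (\<lambda>z. c * f z) h = c * l2_inner M f h"
  by (simp add: l2_inner_def mult.assoc)

lemma l2_inner_zero_left: "l2_inner M (\<lambda>z. 0) h = 0"
  by (simp add: l2_inner_def)

lemma l2_inner_self: "l2_inner M f f = of_real (LINT z|M. (cmod (f z))\<^sup>2)"
  by (simp add: l2_inner_def complex_norm_square[symmetric] flip: of_real_power)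

lemma l2_norm_cmult: "l2_norm M (\<lambda>z. c * f z) = cmod c * l2_norm M f"
  by (simp add: l2_norm_def norm_mult power_mult_distrib real_sqrt_mult)

text \<open>A weak form of Cauchy-Schwarz: with \<open>B\<close> the squared norm of
  \<open>h\<close>, the constant is (1 + B)/2 instead of the square root of \<open>B\<close>. Any
  constant independent of \<open>f\<close> suffices for bounding operators.\<close>

lemma l2_inner_bounded:
  assumes "sq_integrable M h"
  obtains C where "\<And>f. sq_integrable M f \<Longrightarrow> cmod (l2_inner M f h) \<le> C * l2_norm M f"
proof
  define B where "B = (LINT z|M. (cmod (h z))\<^sup>2)"
  fix f assume f: "sq_integrable M f"
  define A where "A = l2_norm M f"
  have A2: "A\<^sup>2 = (LINT z|M. (cmod (f z))\<^sup>2)" and "A \<ge> 0"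
    by (simp_all add: A_def l2_norm_def)
  have int: "integrable M (\<lambda>z. f z * cnj (h z))"
    using f assms by (rule sq_integrable_mult_cnj)
  show "cmod (l2_inner M f h) \<le> ((1 + B) / 2) * l2_norm M f"
  \<comment> \<open>The main estimate divides by \<open>A\<close>; when \<open>A = 0\<close>, the
    function \<open>f\<close> vanishes almost everywhere.\<close>
  proof (cases "A = 0")
    case True
    then have "AE z in M. (cmod (f z))\<^sup>2 = 0"
      using f A2 integral_nonneg_eq_0_iff_AE[of M "\<lambda>z. (cmod (f z))\<^sup>2"]
      by (simp add: sq_integrable_def)
    then have "AE z in M. f z * cnj (h z) = 0"
      by eventually_elim simp
    then have "l2_inner M f h = 0"
      unfolding l2_inner_def by (rule integral_eq_zero_AE)
    with True show ?thesis by (simp add: A_def)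
  next
    case False
    with \<open>A \<ge> 0\<close> have "A > 0" by simp
    have "cmod (l2_inner M f h) \<le> (LINT z|M. cmod (f z * cnj (h z)))"
      unfolding l2_inner_def by (rule integral_norm_bound)
    \<comment> \<open>The inequality 2ab \<le> a^2 + b^2 is applied to |f|/A and |h|. Normalising
      \<open>f\<close> makes the bound linear in \<open>A\<close> after integration.\<close>
    also have "\<dots> \<le> (LINT z|M. A / 2 * ((cmod (f z))\<^sup>2 / A\<^sup>2 + (cmod (h z))\<^sup>2))"
    proof (rule integral_mono)
      show "integrable M (\<lambda>z. cmod (f z * cnj (h z)))"
        using int by (rule integrable_norm)
      show "integrable M (\<lambda>z. A / 2 * ((cmod (f z))\<^sup>2 / A\<^sup>2 + (cmod (h z))\<^sup>2))"
        using f assms by (simp add: sq_integrable_def)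
      fix z
      have "2 * (cmod (f z) / A) * cmod (h z) \<le> (cmod (f z) / A)\<^sup>2 + (cmod (h z))\<^sup>2"
        by (rule sum_squares_bound)
      then have "A / 2 * (2 * (cmod (f z) / A) * cmod (h z))
          \<le> A / 2 * ((cmod (f z) / A)\<^sup>2 + (cmod (h z))\<^sup>2)"
        using \<open>A > 0\<close> by (intro mult_left_mono) auto
      then show "cmod (f z * cnj (h z)) \<le> A / 2 * ((cmod (f z))\<^sup>2 / A\<^sup>2 + (cmod (h z))\<^sup>2)"
        using \<open>A > 0\<close> by (simp add: norm_mult power_divide)
    qed
    also have "\<dots> = A / 2 * (A\<^sup>2 / A\<^sup>2 + B)"
      using f assms by (simp add: sq_integrable_def A2 B_def)
    finally show ?thesis
      using \<open>A > 0\<close> by (simp add: A_def[symmetric] algebra_simps)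
  qed
qed

section \<open>Compressions of multiplication operators\<close>

text \<open>The predicate under the \<open>THE\<close> in \<open>orth_proj\<close>, named so that
  existence can be discussed apart from the value of the description.\<close>

definition has_orth_proj ::
  "complex measure \<Rightarrow> (complex \<Rightarrow> complex) set \<Rightarrow> (complex \<Rightarrow> complex) \<Rightarrow> (complex \<Rightarrow> complex) \<Rightarrow> bool" where
  "has_orth_proj M H u h \<longleftrightarrow> h \<in> H \<and> (\<forall>g\<in>H. l2_inner M (\<lambda>z. u z - h z) g = 0)"

text \<open>Applied to differences, \<open>definite\<close> says that distinct members of
  \<open>H\<close> are distinct L2 classes; this makes projections unique.\<close>

locale l2_subspace =
  fixes M :: "complex measure" and H :: "(complex \<Rightarrow> complex) set"
  assumes sq: "f \<in> H \<Longrightarrow> sq_integrable M f"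
    and add: "f \<in> H \<Longrightarrow> g \<in> H \<Longrightarrow> (\<lambda>z. f z + g z) \<in> H"
    and cmult: "f \<in> H \<Longrightarrow> (\<lambda>z. c * f z) \<in> H"
    and definite: "f \<in> H \<Longrightarrow> l2_inner M f f = 0 \<Longrightarrow> f = (\<lambda>z. 0)"
begin

lemma diff: "f \<in> H \<Longrightarrow> g \<in> H \<Longrightarrow> (\<lambda>z. f z - g z) \<in> H"
  using add[OF _ cmult[of g "-1"], of f] by simp

lemma has_orth_proj_iff:
  assumes "sq_integrable M u"
  shows "has_orth_proj M H u h \<longleftrightarrow> h \<in> H \<and> (\<forall>g\<in>H. l2_inner M u g = l2_inner M h g)"
  using assms sq by (auto simp: has_orth_proj_def l2_inner_diff_left)

lemma has_orth_proj_unique: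
  assumes "sq_integrable M u" "has_orth_proj M H u h" "has_orth_proj M H u k"
  shows "h = k"
proof -
  have hk: "h \<in> H" "k \<in> H" and eq: "\<And>g. g \<in> H \<Longrightarrow> l2_inner M h g = l2_inner M k g"
    using assms by (auto simp: has_orth_proj_iff)
  have "(\<lambda>z. h z - k z) = (\<lambda>z. 0)"
    using diff[OF hk] hk sq eq by (intro definite) (simp_all add: l2_inner_diff_left)
  then show ?thesis
    by (simp add: fun_eq_iff)
qed

lemma has_orth_proj_cmult:
  assumes "sq_integrable M u" "has_orth_proj M H u h"
  shows "has_orth_proj M H (\<lambda>z. c * u z) (\<lambda>z. c * h z)"
  using assms cmult by (auto simp: has_orth_proj_iff sq_integrable_cmult l2_inner_cmult_left)

lemma has_orth_proj_diff:
  assumes "sq_integrable M u" "sq_integrable M v" "has_orth_proj M H u h" "has_orth_proj M H v k"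
  shows "has_orth_proj M H (\<lambda>z. u z - v z) (\<lambda>z. h z - k z)"
  using assms sq diff sq_integrable_add[OF assms(1) sq_integrable_cmult[OF assms(2), of "-1"]]
  by (auto simp: has_orth_proj_iff l2_inner_diff_left)

text \<open>No completeness of \<open>H\<close> is needed: if some \<open>a f\<^sub>0\<close> had no projection, then the arbitrary value
  of \<open>THE\<close> would be taken at \<open>f\<^sub>0\<close> and at \<open>2 f\<^sub>0\<close>, so it would vanish by homogeneity, and additivity
  would force the whole operator to vanish.\<close>

lemma compression_inner_cong:
  assumes T_def: "T = (\<lambda>f\<in>H. orth_proj M H (\<lambda>z. a z * f z))" and T: "T \<in> bounded_ops M H"
    and a: "\<And>f. f \<in> H \<Longrightarrow> sq_integrable M (\<lambda>z. a z * f z)"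
    and H: "p \<in> H" "q \<in> H" "r \<in> H" "s \<in> H"
    and eq: "\<And>z. p z * cnj (q z) = r z * cnj (s z)"
  shows "l2_inner M (T p) q = l2_inner M (T r) s"
proof (cases "\<forall>f\<in>H. \<exists>h. has_orth_proj M H (\<lambda>z. a z * f z) h")
  case True
  have "l2_inner M (T f) g = l2_inner M (\<lambda>z. a z * f z) g" if "f \<in> H" "g \<in> H" for f g
  proof -
    have "\<exists>!h. has_orth_proj M H (\<lambda>z. a z * f z) h"
      using True that(1) has_orth_proj_unique[OF a] by blast
    from theI'[OF this] have "has_orth_proj M H (\<lambda>z. a z * f z) (T f)"
      using that by (simp add: T_def orth_proj_def has_orth_proj_def)
    then show ?thesis
      using that a by (simp add: has_orth_proj_iff)
  qed
  then show ?thesis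
    using H eq by (simp add: l2_inner_def mult.assoc)
next
  case False
  \<comment> \<open>If no projection exists, the predicate under \<open>THE\<close> is constantly
    \<open>False\<close>, so all such descriptions denote this one value.\<close>
  define J :: "complex \<Rightarrow> complex" where "J = (THE h. False)"
  have junk: "T f = J" if "f \<in> H" "\<nexists>h. has_orth_proj M H (\<lambda>z. a z * f z) h" for f
  proof -
    have "T f = (THE h. has_orth_proj M H (\<lambda>z. a z * f z) h)"
      using that by (simp add: T_def orth_proj_def has_orth_proj_def)
    then show ?thesis
      using that(2) by (simp add: J_def)
  qed
  obtain f0 where f0: "f0 \<in> H" "\<nexists>h. has_orth_proj M H (\<lambda>z. a z * f0 z) h"
    using False by blast
  have T_add: "T (\<lambda>z. f z + g z) = (\<lambda>z. T f z + T g z)" if "f \<in> H" "g \<in> H" for f g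
    using T that by (simp add: bounded_ops_def)
  have T_cmult: "T (\<lambda>z. c * f z) = (\<lambda>z. c * T f z)" if "f \<in> H" for c f
    using T that by (simp add: bounded_ops_def)
  \<comment> \<open>Half of a projection of \<open>2 a f0\<close> would be a projection of
    \<open>a f0\<close>.\<close>
  have "\<nexists>h. has_orth_proj M H (\<lambda>z. a z * (2 * f0 z)) h"
    using has_orth_proj_cmult[OF a[OF cmult[OF f0(1), of 2]], of _ "1/2"] f0(2) by fastforce
  then have "T (\<lambda>z. 2 * f0 z) = J"
    using junk cmult f0(1) by blast
  then have "J z = 2 * J z" for z
    using T_cmult[OF f0(1), of 2] junk[OF f0] by metis
  then have J: "J = (\<lambda>z. 0)" by (simp add: fun_eq_iff)
  have "T g = (\<lambda>z. 0)" if g: "g \<in> H" for g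
  proof (cases "\<exists>h. has_orth_proj M H (\<lambda>z. a z * g z) h")
    case True
    \<comment> \<open>Otherwise subtracting the projection of \<open>a g\<close> would leave a
      projection of \<open>a f0\<close>.\<close>
    then have "\<nexists>h. has_orth_proj M H (\<lambda>z. a z * (f0 z + g z)) h"
      using has_orth_proj_diff[OF a[OF add[OF f0(1) g]] a[OF g]] f0(2) by (fastforce simp: ring_distribs)
    then have "T (\<lambda>z. f0 z + g z) = J"
      using junk add f0(1) g by blast
    then show ?thesis
      using T_add[OF f0(1) g] junk[OF f0] J by simp
  next
    case False
    then show ?thesis using junk g J by simp
  qed
  then show ?thesis
    using H by (simp add: l2_inner_zero_left)
qed

text \<open>The norm of the image is |<f, h>| times the norm of \<open>k\<close>, which the
  Cauchy-Schwarz type bound controls.\<close>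

lemma rank_one_bounded_op:
  assumes "h \<in> H" "k \<in> H"
  shows "(\<lambda>f\<in>H. (\<lambda>z. l2_inner M f h * k z)) \<in> bounded_ops M H"
proof -
  obtain C where C: "\<And>f. sq_integrable M f \<Longrightarrow> cmod (l2_inner M f h) \<le> C * l2_norm M f"
    using l2_inner_bounded[OF sq[OF assms(1)]] by blast
  have "l2_norm M (\<lambda>z. l2_inner M f h * k z) \<le> (C * l2_norm M k) * l2_norm M f" if "f \<in> H" for f
    using mult_right_mono[OF C[OF sq[OF that]], of "l2_norm M k"]
    by (simp add: l2_norm_cmult mult.assoc mult.commute[of "l2_norm M f"]) (simp add: l2_norm_def)
  then have "\<exists>C. \<forall>f\<in>H. l2_norm M (\<lambda>z. l2_inner M f h * k z) \<le> C * l2_norm M f" by blast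
  then show ?thesis
    using assms sq
    by (auto simp: bounded_ops_def cmult add l2_inner_add_left l2_inner_cmult_left distrib_right
        mult.assoc)
qed

text \<open>Disjoint neighbourhoods of the two values at \<open>T0\<close> pull back to a weak
  neighbourhood of \<open>T0\<close> that misses \<open>S\<close>. This neighbourhood consists of
  bounded operators, so agreement is asked only of bounded members of \<open>S\<close>, and
  boundedness of Toeplitz operators need not be established.\<close>

lemma not_weakly_dense:
  assumes "T0 \<in> bounded_ops M H" and H: "p \<in> H" "q \<in> H" "r \<in> H" "s \<in> H"
    and "l2_inner M (T0 p) q \<noteq> l2_inner M (T0 r) s"
    and S: "\<And>T. T \<in> S \<Longrightarrow> T \<in> bounded_ops M H \<Longrightarrow> l2_inner M (T p) q = l2_inner M (T r) s"
  shows "\<not> weakly_dense M H S"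
proof
  assume "weakly_dense M H S"
  then have "T0 \<in> weak_operator_topology M H closure_of S"
    using assms(1) by (simp add: weakly_dense_def)
  then have closure: "\<exists>T. T \<in> S \<and> T \<in> N" if "T0 \<in> N" "openin (weak_operator_topology M H) N" for N
    using that by (simp add: in_closure_of)
  obtain U V where UV: "open U" "open V" "l2_inner M (T0 p) q \<in> U" "l2_inner M (T0 r) s \<in> V"
    "U \<inter> V = {}"
    using hausdorff assms(6) by metis
  let ?N = "{T \<in> bounded_ops M H. l2_inner M (T p) q \<in> U} \<inter> {T \<in> bounded_ops M H. l2_inner M (T r) s \<in> V}"
  have "openin (weak_operator_topology M H) ?N"
    unfolding weak_operator_topology_def using UV H
    by (intro openin_Int topology_generated_by_Basis) blast+
  moreover have "T0 \<in> ?N"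
    using UV assms(1) by simp
  ultimately obtain T where "T \<in> S" "T \<in> ?N"
    using closure[of ?N] by blast
  then show False
    using S UV(5) by auto
qed

end

section \<open>The weighted disk\<close>

text \<open>The area is pi (2s - s^2); dropping the square leaves a bound linear in the
  width.\<close>

lemma emeasure_annulus_le:
  assumes "0 \<le> s" "s \<le> 1"
  shows "emeasure lebesgue (ball (0::complex) 1 - ball 0 (1 - s)) \<le> ennreal (2 * pi * s)"
proof -
  have "emeasure lebesgue (ball (0::complex) 1 - ball 0 (1 - s)) =
      emeasure lebesgue (ball (0::complex) 1) - emeasure lebesgue (ball (0::complex) (1 - s))"
    using assms by (intro emeasure_Diff) (auto simp: emeasure_ball subset_ball)
  also have "\<dots> = ennreal (pi - pi * (1 - s)\<^sup>2)"
    using assms by (simp add: emeasure_ball unit_ball_vol_2 ennreal_minus)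
  also have "\<dots> \<le> ennreal (2 * pi * s)"
    by (intro ennreal_leI) (simp add: power2_eq_square algebra_simps)
  finally show ?thesis .
qed

text \<open>The disk is cut into the dyadic pieces \<open>(1/2)^(k+1) < 1 - |z| \<le> (1/2)^k\<close>; the contributions
  form a geometric series of ratio \<open>2 powr -(1 + \<alpha>)\<close> when \<open>\<alpha> < 0\<close>.\<close>

lemma nn_integral_disk_weight_finite:
  assumes "\<alpha> > -1"
  shows "(\<integral>\<^sup>+z. ennreal ((1 - (cmod z)\<^sup>2) powr \<alpha>) \<partial>lebesgue_on unit_disk) < \<infinity>"
proof -
  \<comment> \<open>Since the base 1 - |z|^2 is at most 1, lowering the exponent only increases the
    weight. This reduces to exponents in (-1, 0].\<close>
  define \<beta> where "\<beta> = min \<alpha> 0"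
  have \<beta>: "-1 < \<beta>" "\<beta> \<le> 0" "\<beta> \<le> \<alpha>"
    using assms by (auto simp: \<beta>_def)
  \<comment> \<open>\<open>A k\<close> is the full annulus 1 - |z| \<le> (1/2)^k, larger than the
    dyadic piece: one suitable index per point is enough, and the other terms are
    nonnegative.\<close>
  define A where "A k = ball (0::complex) 1 - ball 0 (1 - (1/2)^k)" for k :: nat
  define c where "c k = ((1/2)^Suc k) powr \<beta>" for k :: nat
  have A_meas: "A k \<in> sets (lebesgue_on unit_disk)" for k
    by (auto simp: A_def sets_restrict_space_iff)
  have pt: "ennreal ((1 - (cmod z)\<^sup>2) powr \<alpha>) \<le> (\<Sum>k. ennreal (c k) * indicator (A k) z)"
    if z: "z \<in> unit_disk" for z
  proof -
    define t where "t = 1 - cmod z"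
    have t: "0 < t" "t \<le> 1" using z by (auto simp: t_def)
    have "\<exists>k. (1/2)^k < t"
      using real_arch_pow_inv[of t "1/2"] t by auto
    \<comment> \<open>The least such \<open>j\<close> is positive because t \<le> 1; its predecessor
      \<open>k\<close> satisfies (1/2)^(k+1) < t \<le> (1/2)^k.\<close>
    then obtain j where j: "(1/2)^j < t" "\<And>i. i < j \<Longrightarrow> t \<le> (1/2)^i"
      using exists_least_iff[of "\<lambda>k. (1/2)^k < t"] by (metis not_less)
    have "j \<noteq> 0"
      using j(1) t by (intro notI) simp
    then obtain k where k: "j = Suc k"
      using not0_implies_Suc by blast
    have "z \<in> A k"
      using z j(2)[of k] k by (simp add: A_def t_def)
    have "t \<le> 1 - (cmod z)\<^sup>2"
    proof -
      have "(cmod z)\<^sup>2 \<le> cmod z"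
        using z by (simp add: power2_eq_square mult_left_le)
      then show ?thesis by (simp add: t_def)
    qed
    then have "(1 - (cmod z)\<^sup>2) powr \<alpha> \<le> (1 - (cmod z)\<^sup>2) powr \<beta>"
      using \<beta> t by (intro powr_mono') auto
    also have "\<dots> \<le> t powr \<beta>"
      using \<beta> t \<open>t \<le> 1 - (cmod z)\<^sup>2\<close> by (intro powr_mono2') auto
    also have "\<dots> \<le> c k"
      unfolding c_def using \<beta> j(1) k by (intro powr_mono2') auto
    finally have "ennreal ((1 - (cmod z)\<^sup>2) powr \<alpha>) \<le> ennreal (c k) * indicator (A k) z"
      using \<open>z \<in> A k\<close> by (simp add: ennreal_leI)
    also have "\<dots> = (\<Sum>i\<in>{k}. ennreal (c i) * indicator (A i) z)"
      by (simp del: sum_mult_indicator)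
    also have "\<dots> \<le> (\<Sum>k. ennreal (c k) * indicator (A k) z)"
      by (intro sum_le_suminf) auto
    finally show ?thesis .
  qed
  \<comment> \<open>From one index to the next the weight bound gains the factor (1/2)^\<beta> and
    the area bound the factor 1/2. Their product is below 1 because \<beta> > -1.\<close>
  define \<rho> where "\<rho> = (1/2) powr (1 + \<beta>)"
  have \<rho>: "0 \<le> \<rho>" "\<rho> < 1"
    using \<beta> powr_less_mono2[of "1 + \<beta>" "1/2" 1] by (auto simp: \<rho>_def)
  have c_eq: "c k * (2 * pi * (1/2)^k) = (2 * pi * (1/2) powr \<beta>) * \<rho> ^ k" for k
  proof -
    have "c k = ((1/2) powr real (Suc k)) powr \<beta>"
      unfolding c_def by (subst powr_realpow) auto
    also have "\<dots> = ((1/2) powr \<beta>) powr real (Suc k)"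
      by (simp only: powr_powr mult.commute)
    also have "\<dots> = ((1/2) powr \<beta>) ^ Suc k"
      by (subst powr_realpow) auto
    finally have "c k = (1/2) powr \<beta> * ((1/2) powr \<beta>) ^ k" by simp
    moreover have "\<rho> ^ k = ((1/2) powr \<beta>) ^ k * (1/2) ^ k"
      by (simp add: \<rho>_def powr_add power_divide)
    ultimately show ?thesis
      by (simp add: mult_ac)
  qed
  have "(\<integral>\<^sup>+z. ennreal ((1 - (cmod z)\<^sup>2) powr \<alpha>) \<partial>lebesgue_on unit_disk)
      \<le> (\<integral>\<^sup>+z. (\<Sum>k. ennreal (c k) * indicator (A k) z) \<partial>lebesgue_on unit_disk)"
    by (intro nn_integral_mono pt) simp
  also have "\<dots> = (\<Sum>k. ennreal (c k) * emeasure (lebesgue_on unit_disk) (A k))"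
    using A_meas by (subst nn_integral_suminf) (auto simp: nn_integral_cmult_indicator)
  also have "\<dots> \<le> (\<Sum>k. ennreal (c k * (2 * pi * (1/2)^k)))"
  proof (intro suminf_le)
    fix k
    have "emeasure (lebesgue_on unit_disk) (A k) = emeasure lebesgue (A k)"
      by (intro emeasure_restrict_space) (auto simp: A_def)
    also have "\<dots> \<le> ennreal (2 * pi * (1/2)^k)"
      unfolding A_def by (intro emeasure_annulus_le) (auto simp: power_le_one)
    finally show "ennreal (c k) * emeasure (lebesgue_on unit_disk) (A k) \<le> ennreal (c k * (2 * pi * (1/2)^k))"
      by (subst ennreal_mult) (auto simp: c_def intro: mult_left_mono)
  qed auto
  also have "\<dots> < \<infinity>"
  proof -
    have "summable (\<lambda>k. (2 * pi * (1/2) powr \<beta>) * \<rho> ^ k)"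
      using \<rho> by (intro summable_mult summable_geometric) simp
    then have "(\<Sum>k. ennreal (c k * (2 * pi * (1/2)^k))) \<noteq> top"
      unfolding c_eq using \<rho> by (intro ennreal_suminf_neq_top) auto
    then show ?thesis by (simp add: less_top)
  qed
  finally show ?thesis .
qed

section \<open>The weighted measure: finiteness and null sets\<close>

lemma disk_weight_measurable:
  "(\<lambda>z. ennreal ((\<alpha> + 1) / pi * (1 - (cmod z)\<^sup>2) powr \<alpha>)) \<in> borel_measurable (lebesgue_on unit_disk)"
proof -
  have "(\<lambda>z. ennreal ((\<alpha> + 1) / pi * (1 - (cmod z)\<^sup>2) powr \<alpha>)) \<in> borel_measurable lebesgue"
    by (intro measurable_completion) measurable
  then show ?thesis by (rule measurable_restrict_space1)
qed

lemma space_disk_measure [simp]: "space (disk_measure \<alpha>) = unit_disk"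
  by (simp add: disk_measure_def)

lemma sets_disk_measure [simp]: "sets (disk_measure \<alpha>) = sets (lebesgue_on unit_disk)"
  by (simp add: disk_measure_def)

lemma finite_disk_measure:
  assumes "\<alpha> > -1"
  shows "finite_measure (disk_measure \<alpha>)"
proof
  have "emeasure (disk_measure \<alpha>) (space (disk_measure \<alpha>)) =
      (\<integral>\<^sup>+z. ennreal ((\<alpha> + 1) / pi * (1 - (cmod z)\<^sup>2) powr \<alpha>) * indicator unit_disk z \<partial>lebesgue_on unit_disk)"
    using disk_weight_measurable unfolding disk_measure_def
    by (subst emeasure_density) (auto simp: sets_restrict_space_iff)
  also have "\<dots> = (\<integral>\<^sup>+z. ennreal ((\<alpha> + 1) / pi) * ennreal ((1 - (cmod z)\<^sup>2) powr \<alpha>) \<partial>lebesgue_on unit_disk)"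
    using assms by (intro nn_integral_cong) (auto simp flip: ennreal_mult)
  also have "\<dots> = ennreal ((\<alpha> + 1) / pi) * (\<integral>\<^sup>+z. ennreal ((1 - (cmod z)\<^sup>2) powr \<alpha>) \<partial>lebesgue_on unit_disk)"
    by (intro nn_integral_cmult measurable_restrict_space1 measurable_completion) measurable
  also have "\<dots> < \<infinity>"
    using nn_integral_disk_weight_finite[OF assms] by (simp add: ennreal_mult_less_top)
  finally show "emeasure (disk_measure \<alpha>) (space (disk_measure \<alpha>)) \<noteq> \<infinity>"
    by simp
qed

text \<open>The weight is strictly positive on the disk, so it creates no new null sets. This
  transfers essential bounds of symbols, which are stated for Lebesgue measure.\<close>

lemma AE_disk_measure_iff:
  assumes "\<alpha> > -1"
  shows "(AE z in disk_measure \<alpha>. P z) \<longleftrightarrow> (AE z in lebesgue_on unit_disk. P z)"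
proof -
  have "(AE z in disk_measure \<alpha>. P z) \<longleftrightarrow>
      (AE z in lebesgue_on unit_disk. 0 < ennreal ((\<alpha> + 1) / pi * (1 - (cmod z)\<^sup>2) powr \<alpha>) \<longrightarrow> P z)"
    unfolding disk_measure_def using disk_weight_measurable by (rule AE_density)
  also have "\<dots> \<longleftrightarrow> (AE z in lebesgue_on unit_disk. P z)"
  proof (rule AE_cong)
    fix z assume "z \<in> space (lebesgue_on unit_disk)"
    then have "(cmod z)\<^sup>2 < 1"
      by (simp add: abs_square_less_1)
    then show "(0 < ennreal ((\<alpha> + 1) / pi * (1 - (cmod z)\<^sup>2) powr \<alpha>) \<longrightarrow> P z) \<longleftrightarrow> P z"
      using assms by simp
  qed
  finally show ?thesis .
qed

text \<open>The set where \<open>f\<close> is nonzero is open and negligible, hence empty.\<close>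

lemma continuous_AE_zero_disk_measure:
  assumes "\<alpha> > -1" "continuous_on unit_disk f" "AE z in disk_measure \<alpha>. f z = 0" "z \<in> unit_disk"
  shows "f z = (0::complex)"
proof -
  define U where "U = {z \<in> unit_disk. f z \<noteq> 0}"
  have "open (unit_disk \<inter> f -` (- {0}))"
    using assms(2) by (intro continuous_open_preimage) auto
  moreover have "unit_disk \<inter> f -` (- {0}) = U"
    by (auto simp: U_def)
  ultimately have "open U" by simp
  have "AE z in lebesgue_on unit_disk. f z = 0"
    using AE_disk_measure_iff[OF assms(1)] assms(3) by simp
  then have "AE z in lebesgue. z \<notin> U"
    by (simp add: AE_restrict_space_iff U_def)
  then have "negligible U"
    using \<open>open U\<close> by (simp add: negligible_iff_null_sets AE_iff_null_sets)
  then have "U = {}"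
    using \<open>open U\<close> open_not_negligible by blast
  then show ?thesis
    using assms(4) by (simp add: U_def)
qed

lemma borel_measurable_disk_measureI:
  assumes "continuous_on unit_disk f"
  shows "f \<in> borel_measurable (disk_measure \<alpha>)"
proof -
  have "f \<in> borel_measurable (lebesgue_on unit_disk)"
    using assms by (intro continuous_imp_measurable_on_sets_lebesgue) auto
  then show ?thesis
    by (simp cong: measurable_cong_sets)
qed

section \<open>The polyanalytic Bergman space as an instance of \<open>l2_subspace\<close>\<close>

lemma sq_integrable_disk_measureI:
  assumes "\<alpha> > -1" "continuous_on unit_disk f" "\<And>z. z \<in> unit_disk \<Longrightarrow> cmod (f z) \<le> 1"
  shows "sq_integrable (disk_measure \<alpha>) f"
proof -
  interpret finite_measure "disk_measure \<alpha>"
    using assms(1) by (rule finite_disk_measure)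
  have "sq_integrable (disk_measure \<alpha>) (\<lambda>z. 1)"
    by (simp add: sq_integrable_def)
  moreover have "f \<in> borel_measurable (disk_measure \<alpha>)"
    using assms(2) by (rule borel_measurable_disk_measureI)
  ultimately show ?thesis
    by (rule sq_integrable_bound[where C = 1]) (use assms(3) in auto)
qed

lemma poly_bergman_extend_zeroI:
  assumes "\<alpha> > -1" "n_analytic_on n unit_disk f" "\<And>z. z \<in> unit_disk \<Longrightarrow> cmod (f z) \<le> 1"
  shows "(\<lambda>z. if z \<in> unit_disk then f z else 0) \<in> poly_bergman n \<alpha>"
proof -
  let ?g = "\<lambda>z. if z \<in> unit_disk then f z else 0"
  have g: "n_analytic_on n unit_disk ?g"
    using assms(2) by (subst n_analytic_on_cong[where g = f]) auto
  then have "Ck_on 0 unit_disk ?g"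
    unfolding n_analytic_on_def smooth_on_def by blast
  then have "sq_integrable (disk_measure \<alpha>) ?g"
    using assms(1,3) by (intro sq_integrable_disk_measureI) auto
  with g show ?thesis
    by (simp add: poly_bergman_def)
qed

text \<open>Vanishing norm gives zero almost everywhere, continuity gives zero on the disk, and
  outside it members are zero by convention.\<close>

lemma poly_bergman_definite:
  assumes "\<alpha> > -1" "f \<in> poly_bergman n \<alpha>" "l2_inner (disk_measure \<alpha>) f f = 0"
  shows "f = (\<lambda>z. 0)"
proof
  fix z
  have "Ck_on 0 unit_disk f"
    using assms(2) unfolding poly_bergman_def n_analytic_on_def smooth_on_def by blast
  then have cont: "continuous_on unit_disk f" by simp
  have "(LINT z|disk_measure \<alpha>. (cmod (f z))\<^sup>2) = 0"
    using assms(3) by (simp add: l2_inner_self)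
  then have "AE z in disk_measure \<alpha>. (cmod (f z))\<^sup>2 = 0"
    using assms(2) integral_nonneg_eq_0_iff_AE[of "disk_measure \<alpha>" "\<lambda>z. (cmod (f z))\<^sup>2"]
    by (simp add: poly_bergman_def sq_integrable_def)
  then have "AE z in disk_measure \<alpha>. f z = 0"
    by eventually_elim simp
  from continuous_AE_zero_disk_measure[OF assms(1) cont this] show "f z = 0"
    using assms(2) unfolding poly_bergman_def by blast
qed

lemma l2_subspace_poly_bergman:
  assumes "\<alpha> > -1"
  shows "l2_subspace (disk_measure \<alpha>) (poly_bergman n \<alpha>)"
proof
  show "f = (\<lambda>z. 0)" if "f \<in> poly_bergman n \<alpha>" "l2_inner (disk_measure \<alpha>) f f = 0" for f
    using assms that by (rule poly_bergman_definite)
qed (auto simp: poly_bergman_def sq_integrable_add sq_integrable_cmult n_analytic_on_add n_analytic_on_cmult)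

lemma sq_integrable_Linfty_mult:
  assumes "\<alpha> > -1" "a \<in> Linfty_disk" "sq_integrable (disk_measure \<alpha>) f"
  shows "sq_integrable (disk_measure \<alpha>) (\<lambda>z. a z * f z)"
proof -
  obtain C where "AE z in lebesgue_on unit_disk. cmod (a z) \<le> C"
    using assms(2) by (auto simp: Linfty_disk_def)
  then have "AE z in disk_measure \<alpha>. cmod (a z) \<le> C"
    using AE_disk_measure_iff[OF assms(1)] by simp
  then have "AE z in disk_measure \<alpha>. cmod (a z * f z) \<le> C * cmod (f z)"
    by eventually_elim (simp add: norm_mult mult_right_mono)
  moreover have "a \<in> borel_measurable (disk_measure \<alpha>)"
    using assms(2) by (simp add: Linfty_disk_def cong: measurable_cong_sets)
  ultimately show ?thesis
    using assms(3) by (intro sq_integrable_bound[OF assms(3)]) (auto simp: sq_integrable_def)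
qed

section \<open>Separating a rank-one operator from the Toeplitz operators\<close>

theorem theorem6p4:
  fixes \<alpha> :: real and n :: nat
  assumes "\<alpha> > -1" and "n \<ge> 2"
  shows "\<not> weakly_dense (disk_measure \<alpha>) (poly_bergman n \<alpha>)
           {toeplitz n \<alpha> a | a. a \<in> Linfty_disk}"
proof -
  let ?M = "disk_measure \<alpha>" and ?H = "poly_bergman n \<alpha>"
  interpret l2_subspace ?M ?H
    using assms(1) by (rule l2_subspace_poly_bergman)
  define e :: "complex \<Rightarrow> complex" where "e = (\<lambda>z. if z \<in> unit_disk then 1 else 0)"
  define x :: "complex \<Rightarrow> complex" where "x = (\<lambda>z. if z \<in> unit_disk then z else 0)"
  define y :: "complex \<Rightarrow> complex" where "y = (\<lambda>z. if z \<in> unit_disk then cnj z else 0)"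
  have H: "e \<in> ?H" "x \<in> ?H" "y \<in> ?H"
    unfolding e_def x_def y_def
    by (rule poly_bergman_extend_zeroI; use assms in \<open>simp add: n_analytic_on_basic\<close>)+
  define m c where "m = l2_inner ?M e e" and "c = l2_inner ?M e y"
  define h where "h = (\<lambda>z. m * x z - c * e z)"
  have h: "h \<in> ?H"
    unfolding h_def using H by (intro diff cmult)
  define T0 where "T0 = (\<lambda>f\<in>?H. (\<lambda>z. l2_inner ?M f h * e z))"
  have "m \<noteq> 0"
  proof
    assume "m = 0"
    then have "e = (\<lambda>z. 0)"
      using definite H(1) by (simp add: m_def)
    from fun_cong[OF this, of 0] show False by (simp add: e_def)
  qed
  have "l2_inner ?M h h \<noteq> 0"
  proof
    assume "l2_inner ?M h h = 0"
    then have "h = (\<lambda>z. 0)"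
      using definite h by blast
    \<comment> \<open>The value at 0 gives \<open>c = 0\<close>, and then the value at 1/2 gives
      \<open>m = 0\<close>.\<close>
    from fun_cong[OF this, of 0] fun_cong[OF this, of "1/2"] show False
      using \<open>m \<noteq> 0\<close> by (simp add: h_def x_def e_def)
  qed
  show ?thesis
  proof (rule not_weakly_dense)
    show "T0 \<in> bounded_ops ?M ?H"
      unfolding T0_def using h H(1) by (rule rank_one_bounded_op)
    have "l2_inner ?M (T0 x) e - l2_inner ?M (T0 e) y = m * l2_inner ?M x h - c * l2_inner ?M e h"
      using H by (simp add: T0_def l2_inner_cmult_left m_def c_def)
    \<comment> \<open>Only the first argument of <h, h> is expanded; the inner product is linear
      there, so \<open>m\<close> and \<open>c\<close> appear without conjugation.\<close>
    also have "\<dots> = l2_inner ?M h h"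
      using H h sq cmult by (subst (3) h_def) (simp add: l2_inner_diff_left l2_inner_cmult_left)
    also have "\<dots> \<noteq> 0" by fact
    finally show "l2_inner ?M (T0 x) e \<noteq> l2_inner ?M (T0 e) y"
      by simp
  next
    fix T assume "T \<in> {toeplitz n \<alpha> a |a. a \<in> Linfty_disk}" and T: "T \<in> bounded_ops ?M ?H"
    then obtain a where a: "a \<in> Linfty_disk" and T_eq: "T = toeplitz n \<alpha> a" by blast
    \<comment> \<open>On the disk both products are the function z, since z cnj(1) = 1 cnj(cnj
      z).\<close>
    show "l2_inner ?M (T x) e = l2_inner ?M (T e) y"
      using T H sq_integrable_Linfty_mult[OF assms(1) a] sq
      by (intro compression_inner_cong[of T a]) (auto simp: T_eq toeplitz_def x_def y_def e_def)
  qed (fact H)+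
qed

end
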